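(* In the space $B\cup\{\infty\}$ defined in the context, every open set is an $F_\sigma$-set (a countable union of closed sets).
   Context: Here $\mathbb{N}=\{0,1,2,\dots\}$. The Niemytzki plane $N$: the underlying set is $N=\{\langle x,y\rangle\in\mathbb{R}^2: y\ge 0\}$. With $\|\cdot\|$ the Euclidean norm, the topology is given by the following local bases of (not necessarily open) neighbourhoods. If $y>0$, the neighbourhoods of $\langle x,y\rangle$ are $U(x,y,n)=\{\langle u,v\rangle\in N:\|\langle u,v\rangle-\langle x,y\rangle\|<2^{-n}\}$, $n\in\mathbb{N}$. If $y=0$, the neighbourhoods of $\langle x,0\rangle$ are $U(x,n)=U'(x,n)\cup\{\langle x,0\rangle\}$, $n\in\mathbb{N}$, where $U'(x,n)=\{\langle u,v\rangle:\|\langle u,v\rangle-\langle x,2^{-n}\rangle\|<2^{-n}\}$. A set is open if it contains a basic neighbourhood of each of its points. The space $B\cup\{\infty\}$: start with the product $N\times\mathbb{N}$ ($\mathbb{N}$ discrete) and add one point $\infty$ to get $(N\times\mathbb{N})\cup\{\infty\}$, in which $N\times\mathbb{N}$ is an open subspace with its product topology and the basic neighbourhoods of $\infty$ are the sets $U_m=\{\infty\}\cup(N\times\{n\in\mathbb{N}:n\ge m\})$, $m\in\mathbb{N}$. Then $B\cup\{\infty\}$ is the quotient space of $(N\times\mathbb{N})\cup\{\infty\}$, with the quotient topology, obtained by making the following identifications: for every even $n\in\mathbb{N}$ and every rational $q$, the point $(\langle q,0\rangle,n)$ is identified with $(\langle q,0\rangle,n+1)$; for every odd $n\in\mathbb{N}$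 and every irrational $p$, the point $(\langle p,0\rangle,n)$ is identified with $(\langle p,0\rangle,n+1)$. No other identifications are made. *)

theory Defs
  imports "HOL-Analysis.Analysis"
begin

section \<open>The Niemytzki plane\<close>

text \<open>The norm of \<^typ>\<open>real \<times> real\<close> is the Euclidean one, so \<^const>\<open>ball\<close> is a round disc.
  Neighbourhoods are only used at points of \<open>N\<close>, where the second case of
  \<open>niemytzki_nhd\<close> means \<open>y = 0\<close>.\<close>

definition niemytzki_set :: "(real \<times> real) set" where
  "niemytzki_set = {(x, y). y \<ge> 0}"

definition niemytzki_nhd :: "real \<times> real \<Rightarrow> nat \<Rightarrow> (real \<times> real) set" where
  "niemytzki_nhd p n =
     (if snd p > 0 then niemytzki_set \<inter> ball p (1 / 2 ^ n)
      else insert p (ball (fst p, 1 / 2 ^ n) (1 / 2 ^ n)))"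

definition niemytzki_open :: "(real \<times> real) set \<Rightarrow> bool" where
  "niemytzki_open S \<longleftrightarrow> S \<subseteq> niemytzki_set \<and> (\<forall>p\<in>S. \<exists>n. niemytzki_nhd p n \<subseteq> S)"

definition niemytzki :: "(real \<times> real) topology" where
  "niemytzki = topology niemytzki_open"

lemma niemytzki_nhd_mono:
  assumes "m \<le> n" shows "niemytzki_nhd p n \<subseteq> niemytzki_nhd p m"
proof -
  define r where "r = (1 / 2 ^ n :: real)"
  define s where "s = (1 / 2 ^ m :: real)"
  have rs: "r \<le> s" using assms by (simp add: r_def s_def field_simps)
  have "ball (fst p, r) r \<subseteq> ball (fst p, s) s"
    by (rule ball_subset_ball_iff[THEN iffD2]) (use rs in \<open>auto simp: dist_Pair_Pair dist_real_def\<close>)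
  moreover have "ball p r \<subseteq> ball p s" using rs by auto
  ultimately show ?thesis by (auto simp: niemytzki_nhd_def r_def s_def)
qed

lemma niemytzki_nhd_subset:
  assumes "p \<in> niemytzki_set" shows "niemytzki_nhd p n \<subseteq> niemytzki_set"
proof -
  have "ball (x, r) r \<subseteq> niemytzki_set" for x r :: real
  proof
    fix q assume "q \<in> ball (x, r) r"
    then have "dist r (snd q) < r"
      using dist_snd_le[of "(x, r)" q] by (auto simp: mem_ball)
    then show "q \<in> niemytzki_set"
      by (auto simp: niemytzki_set_def dist_real_def case_prod_beta)
  qed
  then show ?thesis using assms by (auto simp: niemytzki_nhd_def)
qed

lemma istopology_niemytzki_open: "istopology niemytzki_open"
  unfolding istopology_def
proof (intro conjI allI impI)
  fix S T assume S: "niemytzki_open S" and T: "niemytzki_open T"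
  show "niemytzki_open (S \<inter> T)"
    unfolding niemytzki_open_def
  proof (intro conjI ballI)
    show "S \<inter> T \<subseteq> niemytzki_set" using S by (auto simp: niemytzki_open_def)
    fix p assume "p \<in> S \<inter> T"
    then obtain m n where "niemytzki_nhd p m \<subseteq> S" "niemytzki_nhd p n \<subseteq> T"
      using S T unfolding niemytzki_open_def by blast
    then have "niemytzki_nhd p (max m n) \<subseteq> S \<inter> T"
      using niemytzki_nhd_mono[of m "max m n" p] niemytzki_nhd_mono[of n "max m n" p] by auto
    then show "\<exists>n. niemytzki_nhd p n \<subseteq> S \<inter> T" ..
  qed
next
  fix \<K> assume "\<forall>K\<in>\<K>. niemytzki_open K"
  then show "niemytzki_open (\<Union>\<K>)"
    unfolding niemytzki_open_def by (metis Sup_le_iff UnionE Sup_upper subset_trans)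
qed

lemma openin_niemytzki: "openin niemytzki S \<longleftrightarrow> niemytzki_open S"
  by (simp add: niemytzki_def istopology_niemytzki_open topology_inverse')

lemma topspace_niemytzki [simp]: "topspace niemytzki = niemytzki_set"
proof -
  have "niemytzki_open niemytzki_set"
    using niemytzki_nhd_subset by (auto simp: niemytzki_open_def)
  moreover have "S \<subseteq> niemytzki_set" if "niemytzki_open S" for S
    using that by (simp add: niemytzki_open_def)
  ultimately show ?thesis by (auto simp: topspace_def openin_niemytzki)
qed


section \<open>The space \<open>(N \<times> \<nat>) \<union> {\<infinity>}\<close>\<close>

text \<open>The point at infinity is \<^const>\<open>None\<close>; the point \<open>(p, n)\<close> of \<open>N \<times> \<nat>\<close> is
  \<^term>\<open>Some (p, n)\<close>.\<close>

definition sequence_at_infinity_open :: "'a topology \<Rightarrow> ('a \<times> nat) option set \<Rightarrow> bool" where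
  "sequence_at_infinity_open X S \<longleftrightarrow>
     openin (prod_topology X (discrete_topology UNIV)) {z. Some z \<in> S} \<and>
     (None \<in> S \<longrightarrow> (\<exists>m. insert None (Some ` (topspace X \<times> {m..})) \<subseteq> S))"

definition sequence_at_infinity :: "'a topology \<Rightarrow> ('a \<times> nat) option topology" where
  "sequence_at_infinity X = topology (sequence_at_infinity_open X)"

lemma istopology_sequence_at_infinity_open: "istopology (sequence_at_infinity_open X)"
  unfolding istopology_def
proof (intro conjI allI impI)
  fix S T assume S: "sequence_at_infinity_open X S" and T: "sequence_at_infinity_open X T"
  have *: "{z. Some z \<in> S \<inter> T} = {z. Some z \<in> S} \<inter> {z. Some z \<in> T}" by auto
  show "sequence_at_infinity_open X (S \<inter> T)"
    unfolding sequence_at_infinity_open_def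
  proof (intro conjI impI)
    show "openin (prod_topology X (discrete_topology UNIV)) {z. Some z \<in> S \<inter> T}"
      unfolding * using S T by (auto simp: sequence_at_infinity_open_def)
    assume "None \<in> S \<inter> T"
    then obtain m n where
      "insert None (Some ` (topspace X \<times> {m..})) \<subseteq> S"
      "insert None (Some ` (topspace X \<times> {n..})) \<subseteq> T"
      using S T unfolding sequence_at_infinity_open_def by blast
    then have "insert None (Some ` (topspace X \<times> {max m n..})) \<subseteq> S \<inter> T"
      by (auto simp: image_subset_iff)
    then show "\<exists>m. insert None (Some ` (topspace X \<times> {m..})) \<subseteq> S \<inter> T" ..
  qed
next
  fix \<K> assume K: "\<forall>K\<in>\<K>. sequence_at_infinity_open X K"
  have *: "{z. Some z \<in> \<Union>\<K>} = (\<Union>K\<in>\<K>. {z. Some z \<in> K})" by auto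
  show "sequence_at_infinity_open X (\<Union>\<K>)"
    unfolding sequence_at_infinity_open_def
  proof (intro conjI impI)
    show "openin (prod_topology X (discrete_topology UNIV)) {z. Some z \<in> \<Union>\<K>}"
      unfolding * using K by (intro openin_Union) (auto simp: sequence_at_infinity_open_def)
    assume "None \<in> \<Union>\<K>"
    then obtain L where L: "L \<in> \<K>" "None \<in> L" by blast
    then obtain m where "insert None (Some ` (topspace X \<times> {m..})) \<subseteq> L"
      using K unfolding sequence_at_infinity_open_def by blast
    then show "\<exists>m. insert None (Some ` (topspace X \<times> {m..})) \<subseteq> \<Union>\<K>" using L by blast
  qed
qed

lemma openin_sequence_at_infinity:
  "openin (sequence_at_infinity X) S \<longleftrightarrow> sequence_at_infinity_open X S"
  by (simp add: sequence_at_infinity_def istopology_sequence_at_infinity_open topology_inverse')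

lemma topspace_sequence_at_infinity [simp]:
  "topspace (sequence_at_infinity X) = insert None (Some ` (topspace X \<times> UNIV))"
proof (rule antisym)
  show "topspace (sequence_at_infinity X) \<subseteq> insert None (Some ` (topspace X \<times> UNIV))"
  proof
    fix z assume "z \<in> topspace (sequence_at_infinity X)"
    then obtain S where S: "sequence_at_infinity_open X S" "z \<in> S"
      by (auto simp: topspace_def openin_sequence_at_infinity)
    then have "{z. Some z \<in> S} \<subseteq> topspace X \<times> UNIV"
      using openin_subset unfolding sequence_at_infinity_open_def by fastforce
    then show "z \<in> insert None (Some ` (topspace X \<times> UNIV))"
      using S(2) by (cases z) auto
  qed
  have "{z. Some z \<in> insert None (Some ` (topspace X \<times> UNIV))} = topspace X \<times> (UNIV :: nat set)"
    by auto
  then have "sequence_at_infinity_open X (insert None (Some ` (topspace X \<times> UNIV)))"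
    unfolding sequence_at_infinity_open_def
    by (auto simp: openin_prod_Times_iff)
  then show "insert None (Some ` (topspace X \<times> UNIV)) \<subseteq> topspace (sequence_at_infinity X)"
    by (intro openin_subset) (simp add: openin_sequence_at_infinity)
qed


section \<open>Quotient spaces\<close>

definition equivalence_generated :: "'a set \<Rightarrow> ('a \<times> 'a) set \<Rightarrow> ('a \<times> 'a) set" where
  "equivalence_generated A r = (r \<union> r\<inverse>)\<^sup>* \<inter> A \<times> A"

text \<open>The points of the quotient are the equivalence classes.\<close>

definition quotient_space :: "'a topology \<Rightarrow> ('a \<times> 'a) set \<Rightarrow> 'a set topology" where
  "quotient_space X E =
     topology (\<lambda>V. V \<subseteq> topspace X // E \<and> openin X {x \<in> topspace X. E `` {x} \<in> V})"

lemma equiv_equivalence_generated: "equiv A (equivalence_generated A r)"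
proof (rule equivI)
  show "equivalence_generated A r \<subseteq> A \<times> A" by (auto simp: equivalence_generated_def)
  show "refl_on A (equivalence_generated A r)"
    by (auto simp: equivalence_generated_def refl_on_def)
  have "sym ((r \<union> r\<inverse>)\<^sup>*)" by (intro sym_rtrancl sym_Un_converse)
  then show "sym (equivalence_generated A r)"
    by (auto simp: equivalence_generated_def sym_def)
  show "trans (equivalence_generated A r)"
    by (auto simp: equivalence_generated_def trans_def)
qed

lemma openin_quotient_space:
  "openin (quotient_space X E) V \<longleftrightarrow>
     V \<subseteq> topspace X // E \<and> openin X {x \<in> topspace X. E `` {x} \<in> V}"
proof -
  have "istopology (\<lambda>V. V \<subseteq> topspace X // E \<and> openin X {x \<in> topspace X. E `` {x} \<in> V})"
    unfolding istopology_def
  proof (intro conjI allI impI)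
    fix S T
    assume S: "S \<subseteq> topspace X // E \<and> openin X {x \<in> topspace X. E `` {x} \<in> S}"
      and T: "T \<subseteq> topspace X // E \<and> openin X {x \<in> topspace X. E `` {x} \<in> T}"
    show "S \<inter> T \<subseteq> topspace X // E" using S by auto
    have "{x \<in> topspace X. E `` {x} \<in> S \<inter> T} =
        {x \<in> topspace X. E `` {x} \<in> S} \<inter> {x \<in> topspace X. E `` {x} \<in> T}" by auto
    then show "openin X {x \<in> topspace X. E `` {x} \<in> S \<inter> T}" using S T by auto
  next
    fix \<K> assume K: "\<forall>K\<in>\<K>. K \<subseteq> topspace X // E \<and> openin X {x \<in> topspace X. E `` {x} \<in> K}"
    show "\<Union>\<K> \<subseteq> topspace X // E" using K by auto
    have "{x \<in> topspace X. E `` {x} \<in> \<Union>\<K>} = (\<Union>K\<in>\<K>. {x \<in> topspace X. E `` {x} \<in> K})" by auto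
    then show "openin X {x \<in> topspace X. E `` {x} \<in> \<Union>\<K>}" using K by auto
  qed
  then show ?thesis by (simp add: quotient_space_def topology_inverse')
qed

lemma topspace_quotient_space [simp]: "topspace (quotient_space X E) = topspace X // E"
proof -
  have "{x \<in> topspace X. E `` {x} \<in> topspace X // E} = topspace X"
    by (auto simp: quotientI)
  then have "openin (quotient_space X E) (topspace X // E)"
    by (simp add: openin_quotient_space)
  moreover have "openin (quotient_space X E) V \<Longrightarrow> V \<subseteq> topspace X // E" for V
    by (simp add: openin_quotient_space)
  ultimately show ?thesis by (auto simp: topspace_def)
qed

lemma quotient_map_quotient_space: "quotient_map X (quotient_space X E) (\<lambda>x. E `` {x})"
  by (auto simp: quotient_map_def openin_quotient_space quotient_def)


section \<open>The space \<open>B \<union> {\<infinity>}\<close>\<close>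

definition B_identifications ::
    "(((real \<times> real) \<times> nat) option \<times> ((real \<times> real) \<times> nat) option) set" where
  "B_identifications =
     {(Some ((q, 0), n), Some ((q, 0), n + 1)) | q n. even n \<and> q \<in> \<rat>} \<union>
     {(Some ((p, 0), n), Some ((p, 0), n + 1)) | p n. odd n \<and> p \<notin> \<rat>}"

definition B_infinity :: "((real \<times> real) \<times> nat) option set topology" where
  "B_infinity =
     (let X = sequence_at_infinity niemytzki
      in quotient_space X (equivalence_generated (topspace X) B_identifications))"

end

theory Submission
  imports Defs
begin

text \<open>
  No point is identified with points beyond an adjacent level of \<open>N \<times> \<nat>\<close>, and the identifications
  only touch the boundary lines \<open>y = 0\<close>.  Both facts are read off from a normal form of points
  (\<open>boundary_normal_form\<close>) that is constant on equivalence classes.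

  An open set of the quotient is the union of the images of its slices \<open>S \<times> {n}\<close>, with \<open>S\<close> open in the
  Niemytzki plane, and possibly the point at infinity, which is closed.  Each slice splits in two.
  The part of \<open>S\<close> with \<open>y > 0\<close> is open in the Euclidean plane, hence a countable union of
  Euclidean closed sets; these are closed in the finer Niemytzki topology, and since no point with
  \<open>y > 0\<close> is identified with another one they have closed images
  (\<open>closedin_B_infinity_interior_image\<close>).  The part of \<open>S\<close> on the boundary has a closed
  image for a different reason: every subset of the boundary is closed in the Niemytzki plane, so
  saturating under the identifications, which reaches no level above \<open>n + 1\<close>, yields a set that
  is closed on each level; living on finitely many levels, it stays away from infinity
  (\<open>closedin_B_infinity_boundary_image\<close>).  Countably many levels give countably many closed sets.
\<close>

section \<open>The Niemytzki plane\<close>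

lemma ball_tangent_subset:
  fixes r :: real
  shows "ball (x, r) r \<subseteq> ball (x, 0) (2 * r)"
proof
  fix q assume q: "q \<in> ball (x, r) r"
  then have "0 < r"
    by (metis ball_eq_empty empty_iff not_less)
  then have "dist (x, 0) (x, r) = r"
    by (simp add: dist_Pair_Pair dist_real_def)
  then show "q \<in> ball (x, 0) (2 * r)"
    using q dist_triangle[of "(x, 0)" q "(x, r)"] by simp
qed

lemma openin_niemytzki_euclidean:
  assumes "open U"
  shows "openin niemytzki (U \<inter> niemytzki_set)"
  unfolding openin_niemytzki niemytzki_open_def
proof (intro conjI ballI)
  show "U \<inter> niemytzki_set \<subseteq> niemytzki_set" by auto
  fix p assume p: "p \<in> U \<inter> niemytzki_set"
  then obtain e where e: "e > 0" "ball p e \<subseteq> U"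
    using assms open_contains_ball by blast
  obtain n where n: "(1/2) ^ n < e / 2"
    using real_arch_pow_inv[of "e / 2" "1/2"] e by auto
  then have n: "2 * (1 / 2 ^ n) < e"
    by (simp add: power_divide)
  have "niemytzki_nhd p n \<subseteq> ball p e"
  proof (cases "snd p > 0")
    case True
    have "1 / 2 ^ n < e"
      using n by (smt (verit) divide_nonneg_nonneg zero_le_power)
    then have "ball p (1 / 2 ^ n) \<subseteq> ball p e"
      by (intro subset_ball) simp
    then show ?thesis
      using True by (auto simp: niemytzki_nhd_def)
  next
    case False
    then have "p = (fst p, 0)"
      using p by (auto simp: niemytzki_set_def)
    then have "ball (fst p, 1 / 2 ^ n) (1 / 2 ^ n) \<subseteq> ball p (2 * (1 / 2 ^ n))"
      using ball_tangent_subset[of "fst p" "1 / 2 ^ n"] by metis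
    also have "\<dots> \<subseteq> ball p e"
      using n by (intro subset_ball) simp
    finally show ?thesis
      using False e by (auto simp: niemytzki_nhd_def)
  qed
  then show "\<exists>n. niemytzki_nhd p n \<subseteq> U \<inter> niemytzki_set"
    using e niemytzki_nhd_subset[of p n] p by blast
qed

lemma closedin_niemytzki_euclidean:
  assumes "closed C" "C \<subseteq> niemytzki_set"
  shows "closedin niemytzki C"
proof -
  have "niemytzki_set - C = - C \<inter> niemytzki_set" by auto
  then show ?thesis
    using assms openin_niemytzki_euclidean[of "- C"] by (simp add: closedin_def open_Compl)
qed

text \<open>A basic neighbourhood of a boundary point meets the boundary in that point only.\<close>

lemma closedin_niemytzki_boundary:
  assumes "A \<subseteq> {p. snd p = 0}"
  shows "closedin niemytzki A"
  unfolding closedin_def topspace_niemytzki openin_niemytzki niemytzki_open_def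
proof (intro conjI ballI)
  show "A \<subseteq> niemytzki_set" using assms by (auto simp: niemytzki_set_def)
  fix p assume p: "p \<in> niemytzki_set - A"
  show "\<exists>n. niemytzki_nhd p n \<subseteq> niemytzki_set - A"
  proof (cases "snd p > 0")
    case True
    have "open {q :: real \<times> real. snd q > 0}"
      by (intro open_Collect_less continuous_intros)
    then have "openin niemytzki ({q. snd q > 0} \<inter> niemytzki_set)"
      by (rule openin_niemytzki_euclidean)
    then obtain n where "niemytzki_nhd p n \<subseteq> {q. snd q > 0} \<inter> niemytzki_set"
      using True p unfolding openin_niemytzki niemytzki_open_def by blast
    then show ?thesis
      using assms by force
  next
    case False
    have "snd q > 0" if "q \<in> ball (fst p, r) r" for q and r :: real
      using that dist_snd_le[of "(fst p, r)" q] by (auto simp: dist_real_def)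
    then have "niemytzki_nhd p 0 \<inter> A = {}"
      using False p assms by (force simp: niemytzki_nhd_def)
    then show ?thesis
      using niemytzki_nhd_subset[of p 0] p by blast
  qed
qed (auto)

lemma open_niemytzki_interior:
  assumes "openin niemytzki S"
  shows "open (S \<inter> {p. snd p > 0})"
proof (rule Topological_Spaces.openI)
  fix p assume p: "p \<in> S \<inter> {p. snd p > 0}"
  then obtain n where n: "niemytzki_nhd p n \<subseteq> S"
    using assms unfolding openin_niemytzki niemytzki_open_def by blast
  let ?T = "ball p (1 / 2 ^ n) \<inter> {q. snd q > 0}"
  have "open {q :: real \<times> real. snd q > 0}"
    by (intro open_Collect_less continuous_intros)
  then have "open ?T" by blast
  moreover have "?T \<subseteq> S \<inter> {p. snd p > 0}"
    using n p by (auto simp: niemytzki_nhd_def niemytzki_set_def)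
  ultimately show "\<exists>T. open T \<and> p \<in> T \<and> T \<subseteq> S \<inter> {p. snd p > 0}"
    using p by (intro exI[of _ ?T]) auto
qed

section \<open>Sequences of copies of a space\<close>

lemma openin_prod_discrete_slices:
  fixes T :: "('a \<times> 'b) set"
  shows "openin (prod_topology X (discrete_topology UNIV)) T \<longleftrightarrow> (\<forall>n. openin X {p. (p, n) \<in> T})"
proof
  assume T: "openin (prod_topology X (discrete_topology UNIV)) T"
  show "\<forall>n. openin X {p. (p, n) \<in> T}"
  proof
    fix n :: 'b
    have "continuous_map X (prod_topology X (discrete_topology UNIV)) (\<lambda>p. (p, n))"
      by (intro continuous_intros) auto
    then have "openin X {p \<in> topspace X. (p, n) \<in> T}"
      using T by (rule openin_continuous_map_preimage)
    moreover have "{p \<in> topspace X. (p, n) \<in> T} = {p. (p, n) \<in> T}"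
      using openin_subset[OF T] by auto
    ultimately show "openin X {p. (p, n) \<in> T}" by simp
  qed
next
  assume "\<forall>n. openin X {p. (p, n) \<in> T}"
  then have "openin (prod_topology X (discrete_topology UNIV)) (\<Union>n. {p. (p, n) \<in> T} \<times> {n})"
    by (intro openin_Union) (auto simp: openin_prod_Times_iff)
  moreover have "(\<Union>n. {p. (p, n) \<in> T} \<times> {n}) = T" by auto
  ultimately show "openin (prod_topology X (discrete_topology UNIV)) T" by simp
qed

text \<open>Missing all levels above \<open>m\<close> keeps the set away from the point at infinity.\<close>

lemma closedin_sequence_at_infinity_bounded:
  assumes sub: "S \<subseteq> Some ` (topspace X \<times> {..m})"
    and slices: "\<And>n. closedin X {p. Some (p, n) \<in> S}"
  shows "closedin (sequence_at_infinity X) S"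
  unfolding closedin_def openin_sequence_at_infinity sequence_at_infinity_open_def
proof (intro conjI impI)
  let ?C = "topspace (sequence_at_infinity X) - S"
  show "S \<subseteq> topspace (sequence_at_infinity X)"
    using sub by auto
  have "{p. Some (p, n) \<in> ?C} = topspace X - {p. Some (p, n) \<in> S}" for n
    by auto
  then show "openin (prod_topology X (discrete_topology UNIV)) {z. Some z \<in> ?C}"
    using slices by (simp add: openin_prod_discrete_slices openin_diff)
  have "insert None (Some ` (topspace X \<times> {Suc m..})) \<subseteq> ?C"
    using sub by auto
  then show "\<exists>m. insert None (Some ` (topspace X \<times> {m..})) \<subseteq> ?C" ..
qed

lemma closedin_sequence_at_infinity_None: "closedin (sequence_at_infinity X) {None}"
proof -
  have "openin X {p. Some (p, n) \<in> topspace (sequence_at_infinity X) - {None}}" for n :: nat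
    by (simp add: image_iff)
  then show ?thesis
    by (simp add: closedin_def openin_sequence_at_infinity sequence_at_infinity_open_def
        openin_prod_discrete_slices)
qed

section \<open>The equivalence classes\<close>

definition B_equiv ::
    "(((real \<times> real) \<times> nat) option \<times> ((real \<times> real) \<times> nat) option) set" where
  "B_equiv = equivalence_generated (topspace (sequence_at_infinity niemytzki)) B_identifications"

abbreviation B_class where
  "B_class x \<equiv> B_equiv `` {x}"

text \<open>
  A point of an identified pair is moved to the lower level of the pair: rational boundary
  points are paired on levels \<open>2k\<close> and \<open>2k + 1\<close>, irrational ones on levels \<open>2k - 1\<close> and \<open>2k\<close>.  For \<open>k = 0\<close> the truncated
  subtraction assigns level 0 to an irrational boundary point of level 0, which is alone in its class.
\<close>

definition boundary_normal_form ::
    "((real \<times> real) \<times> nat) option \<Rightarrow> ((real \<times> real) \<times> nat) option" where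
  "boundary_normal_form = map_option (\<lambda>((x, y), n).
     ((x, y), if y \<noteq> 0 then n else if x \<in> \<rat> then 2 * (n div 2) else 2 * ((n + 1) div 2) - 1))"

lemma boundary_normal_form_identified:
  assumes "(a, b) \<in> B_identifications"
  shows "boundary_normal_form a = boundary_normal_form b"
  using assms by (auto simp: B_identifications_def boundary_normal_form_def elim!: evenE oddE)

lemma boundary_normal_form_equiv:
  assumes "(a, b) \<in> B_equiv"
  shows "boundary_normal_form a = boundary_normal_form b"
proof -
  have "(a, b) \<in> (B_identifications \<union> B_identifications\<inverse>)\<^sup>*"
    using assms unfolding B_equiv_def equivalence_generated_def by blast
  then show ?thesis
    by (induction rule: rtrancl_induct) (auto dest: boundary_normal_form_identified)
qed

lemma B_equiv_None:
  assumes "(None, b) \<in> B_equiv"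
  shows "b = None"
  using boundary_normal_form_equiv[OF assms]
  by (cases b) (auto simp: boundary_normal_form_def)

lemma B_equiv_interior:
  assumes "(Some (p, n), b) \<in> B_equiv" "snd p \<noteq> 0"
  shows "b = Some (p, n)"
  using boundary_normal_form_equiv[OF assms(1)] assms(2)
  by (cases b) (auto simp: boundary_normal_form_def split: prod.splits)

lemma B_equiv_boundary:
  assumes "(Some (p, n), b) \<in> B_equiv" "snd p = 0"
  obtains m where "b = Some (p, m)" "m \<le> Suc n"
proof -
  obtain m where "b = Some (p, m)"
    using boundary_normal_form_equiv[OF assms(1)]
    by (cases b) (auto simp: boundary_normal_form_def split: prod.splits)
  moreover from this have "m \<le> Suc n"
    using boundary_normal_form_equiv[OF assms(1)] assms(2)
    by (auto simp: boundary_normal_form_def split: if_splits prod.splits)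
  ultimately show thesis by (rule that)
qed

section \<open>Closed sets of the quotient\<close>

lemma quotient_map_B_infinity:
  "quotient_map (sequence_at_infinity niemytzki) B_infinity B_class"
  unfolding B_infinity_def B_equiv_def Let_def by (rule quotient_map_quotient_space)

text \<open>Closedness in the quotient is tested on preimages, and the preimage of the image of \<open>C\<close> is
  its saturation \<open>S\<close>.\<close>

lemma closedin_B_infinity_image:
  assumes C: "C \<subseteq> topspace (sequence_at_infinity niemytzki)"
    and S: "S = {b. \<exists>a\<in>C. (a, b) \<in> B_equiv}"
    and closed: "closedin (sequence_at_infinity niemytzki) S"
  shows "closedin B_infinity (B_class ` C)"
proof -
  let ?X = "sequence_at_infinity niemytzki"
  have eq: "equiv (topspace ?X) B_equiv"
    unfolding B_equiv_def by (rule equiv_equivalence_generated)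
  have preimage: "{x \<in> topspace ?X. B_class x \<in> B_class ` C} = S"
  proof -
    have "B_class x \<in> B_class ` C \<longleftrightarrow> (\<exists>a\<in>C. (a, x) \<in> B_equiv)" if "x \<in> topspace ?X" for x
      using that C eq_equiv_class_iff[OF eq] by (metis (no_types, lifting) image_iff subsetD)
    moreover have "S \<subseteq> topspace ?X"
      using closed by (rule closedin_subset)
    ultimately show ?thesis unfolding S by blast
  qed
  have "B_class ` C \<subseteq> topspace B_infinity"
    using C quotient_imp_surjective_map[OF quotient_map_B_infinity] by auto
  moreover have "\<forall>V \<subseteq> topspace B_infinity.
      closedin ?X {x \<in> topspace ?X. B_class x \<in> V} = closedin B_infinity V"
    using quotient_map_B_infinity unfolding quotient_map_closedin by (rule conjunct2)
  ultimately have "closedin ?X {x \<in> topspace ?X. B_class x \<in> B_class ` C} =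
      closedin B_infinity (B_class ` C)"
    by (elim allE impE)
  then show ?thesis
    using closed unfolding preimage by (rule iffD1)
qed

lemma B_equiv_refl:
  "a \<in> topspace (sequence_at_infinity niemytzki) \<Longrightarrow> (a, a) \<in> B_equiv"
  unfolding B_equiv_def equivalence_generated_def by blast

lemma closedin_B_infinity_None: "closedin B_infinity (B_class ` {None})"
proof (rule closedin_B_infinity_image)
  show "{None} = {b. \<exists>a\<in>{None}. (a, b) \<in> B_equiv}"
    using B_equiv_None B_equiv_refl[of None] by auto
qed (auto simp: closedin_sequence_at_infinity_None)

lemma closedin_B_infinity_interior_image:
  assumes C: "closedin niemytzki C" "C \<subseteq> {p. snd p > 0}"
  shows "closedin B_infinity (B_class ` Some ` (C \<times> {n}))"
proof (rule closedin_B_infinity_image)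
  let ?S = "Some ` (C \<times> {n})"
  have sub: "C \<subseteq> topspace niemytzki"
    using C(1) by (rule closedin_subset)
  then show top: "?S \<subseteq> topspace (sequence_at_infinity niemytzki)" by auto
  show "?S = {b. \<exists>a\<in>?S. (a, b) \<in> B_equiv}"
  proof (intro equalityI subsetI)
    fix b assume "b \<in> ?S"
    then show "b \<in> {b. \<exists>a\<in>?S. (a, b) \<in> B_equiv}"
      using top B_equiv_refl by blast
  next
    fix b assume "b \<in> {b. \<exists>a\<in>?S. (a, b) \<in> B_equiv}"
    then obtain p where p: "p \<in> C" "(Some (p, n), b) \<in> B_equiv" by auto
    then have "b = Some (p, n)"
      using C(2) by (intro B_equiv_interior) auto
    then show "b \<in> ?S" using p by auto
  qed
  show "closedin (sequence_at_infinity niemytzki) ?S"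
  proof (rule closedin_sequence_at_infinity_bounded)
    show "?S \<subseteq> Some ` (topspace niemytzki \<times> {..n})" using sub by auto
    fix k
    have "{p. Some (p, k) \<in> ?S} = (if k = n then C else {})" by auto
    then show "closedin niemytzki {p. Some (p, k) \<in> ?S}" using C(1) by simp
  qed
qed

lemma closedin_B_infinity_boundary_image:
  assumes A: "A \<subseteq> {p. snd p = 0}"
  shows "closedin B_infinity (B_class ` Some ` (A \<times> {n}))"
proof (rule closedin_B_infinity_image)
  let ?S = "{b. \<exists>a\<in>Some ` (A \<times> {n}). (a, b) \<in> B_equiv}"
  have top: "A \<subseteq> topspace niemytzki"
    using A by (auto simp: niemytzki_set_def)
  then show "Some ` (A \<times> {n}) \<subseteq> topspace (sequence_at_infinity niemytzki)" by auto
  have sub: "?S \<subseteq> Some ` (A \<times> {..Suc n})"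
  proof
    fix b assume "b \<in> ?S"
    then obtain p where p: "p \<in> A" "(Some (p, n), b) \<in> B_equiv" by auto
    then obtain m where "b = Some (p, m)" "m \<le> Suc n"
      using A by (elim B_equiv_boundary) auto
    then show "b \<in> Some ` (A \<times> {..Suc n})" using p by auto
  qed
  show "closedin (sequence_at_infinity niemytzki) ?S"
  proof (rule closedin_sequence_at_infinity_bounded)
    show "?S \<subseteq> Some ` (topspace niemytzki \<times> {..Suc n})"
      using sub top by blast
    fix k
    have "{p. Some (p, k) \<in> ?S} \<subseteq> {p. snd p = 0}"
      using sub A by blast
    then show "closedin niemytzki {p. Some (p, k) \<in> ?S}"
      by (rule closedin_niemytzki_boundary)
  qed
qed (rule refl)

section \<open>Open sets of the quotient\<close>

lemma fsigma_in_B_infinity_slice: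
  assumes S: "openin niemytzki S"
  shows "fsigma_in B_infinity (B_class ` Some ` (S \<times> {n}))"
proof -
  let ?f = "\<lambda>C. B_class ` Some ` (C \<times> {n})"
  let ?P = "S \<inter> {p. snd p > 0}" and ?A = "S \<inter> {p. snd p = 0}"
  have "fsigma_in euclidean ?P"
    using open_niemytzki_interior[OF S]
    by (simp add: open_imp_fsigma_in metrizable_space_euclidean)
  then obtain C where C: "\<And>k. closed (C k)" "(\<Union>k::nat. C k) = ?P"
    by (auto simp: fsigma_in_ascending)
  have "closedin B_infinity (?f (C k))" for k
  proof (rule closedin_B_infinity_interior_image)
    show pos: "C k \<subseteq> {p. snd p > 0}" using C(2) by blast
    then have "C k \<subseteq> niemytzki_set" by (auto simp: niemytzki_set_def)
    with C(1) show "closedin niemytzki (C k)" by (rule closedin_niemytzki_euclidean)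
  qed
  then have "fsigma_in B_infinity (\<Union>k. ?f (C k))"
    by (intro fsigma_in_Union) (auto simp: closed_imp_fsigma_in)
  moreover have "fsigma_in B_infinity (?f ?A)"
    by (intro closed_imp_fsigma_in closedin_B_infinity_boundary_image) auto
  moreover have "?f S = (\<Union>k. ?f (C k)) \<union> ?f ?A"
  proof -
    have "S \<subseteq> niemytzki_set"
      using openin_subset[OF S] by simp
    then have "S = ?P \<union> ?A" by (force simp: niemytzki_set_def)
    then have "S = (\<Union>k. C k) \<union> ?A" using C(2) by simp
    then have "S \<times> {n} = (\<Union>k. C k \<times> {n}) \<union> ?A \<times> {n}" by blast
    then have "?f S = B_class ` Some ` ((\<Union>k. C k \<times> {n}) \<union> ?A \<times> {n})" by (rule arg_cong)
    then show ?thesis by (simp only: image_Un image_UN)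
  qed
  ultimately show ?thesis by (simp add: fsigma_in_Un)
qed

theorem proposition2p5:
  shows "\<forall>U. openin B_infinity U \<longrightarrow> fsigma_in B_infinity U"
proof (intro allI impI)
  fix U assume U: "openin B_infinity U"
  let ?X = "sequence_at_infinity niemytzki"
  define W where "W = {x \<in> topspace ?X. B_class x \<in> U}"
  define S where "S n = {p. Some (p, n) \<in> W}" for n
  have "openin ?X W"
    unfolding W_def using quotient_imp_continuous_map[OF quotient_map_B_infinity] U
    by (rule openin_continuous_map_preimage)
  then have "openin niemytzki (S n)" for n
    by (simp add: S_def openin_sequence_at_infinity sequence_at_infinity_open_def
        openin_prod_discrete_slices)
  then have "fsigma_in B_infinity (\<Union>n. B_class ` Some ` (S n \<times> {n}))"
    by (intro fsigma_in_Union) (auto intro: fsigma_in_B_infinity_slice)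
  moreover have "fsigma_in B_infinity (B_class ` (W \<inter> {None}))"
    by (cases "None \<in> W")
      (use closedin_B_infinity_None closed_imp_fsigma_in in auto)
  moreover have "U = (\<Union>n. B_class ` Some ` (S n \<times> {n})) \<union> B_class ` (W \<inter> {None})"
  proof -
    have "W = (\<Union>n. Some ` (S n \<times> {n})) \<union> (W \<inter> {None})"
    proof (rule set_eqI)
      fix x show "x \<in> W \<longleftrightarrow> x \<in> (\<Union>n. Some ` (S n \<times> {n})) \<union> (W \<inter> {None})"
        by (cases x) (auto simp: S_def)
    qed
    then have "B_class ` W = B_class ` ((\<Union>n. Some ` (S n \<times> {n})) \<union> (W \<inter> {None}))"
      by simp
    moreover have "U = B_class ` W"
    proof -
      have "U \<subseteq> B_class ` topspace ?X"
        unfolding quotient_imp_surjective_map[OF quotient_map_B_infinity]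
        using U by (rule openin_subset)
      then show ?thesis unfolding W_def by blast
    qed
    ultimately show ?thesis
      by (simp only: image_Un image_UN)
  qed
  ultimately show "fsigma_in B_infinity U"
    by (simp add: fsigma_in_Un)
qed

end
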